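(* Let $\Delta(n)$ be a function of $n$ with nonnegative integer values such that $2\Delta(n) \le n$ for all $n$ and $\Delta(n) = o(n)$. Then \[ \lim_{n\to\infty} \frac{1}{n}\log_2 F(n,\lfloor n/2\rfloor,\Delta(n)) = 1. \]
   Context: For a finite graph $G$, a permutation of the vertices of $G$ is a sequence listing every vertex of $G$ exactly once; two such permutations $\pi,\sigma$ are $G$-different if there is an index $i$ such that $\{\pi(i),\sigma(i)\}$ is an edge of $G$; $F(G)$ denotes the maximum size of a family of pairwise $G$-different permutations of the vertices of $G$. For a subgraph $G$ of $K_{a,n-a}$ on the same $n$ vertices (with the same bipartition), the bipartite complement of $G$ is the graph on the same vertices whose edges are the edges of $K_{a,n-a}$ not in $G$. $F(n,a,\Delta)$ denotes the minimum of $F(G)$ over all $n$-vertex bipartite graphs $G$ that are subgraphs of $K_{a,n-a}$ and whose bipartite complement has maximum degree $\Delta$. *)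

theory Defs
  imports Complex_Main "HOL-Combinatorics.Multiset_Permutations" "HOL-Library.Landau_Symbols"
begin

text \<open>
  A finite simple graph is given by its vertex set \<open>V\<close> and its set \<open>E\<close> of edges, an edge being
  the set of its two distinct endpoints. A permutation of the vertices is a list in
  \<open>permutations_of_set V\<close>.
\<close>

definition graph_different :: "'a set set \<Rightarrow> 'a list \<Rightarrow> 'a list \<Rightarrow> bool" where
  "graph_different E p q \<longleftrightarrow> (\<exists>i < min (length p) (length q). {p ! i, q ! i} \<in> E)"

definition max_different_perms :: "'a set \<Rightarrow> 'a set set \<Rightarrow> nat" where
  "max_different_perms V E =
     Max {card P | P. P \<subseteq> permutations_of_set V \<and> pairwise (graph_different E) P}"

definition degree :: "'a set set \<Rightarrow> 'a \<Rightarrow> nat" where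
  "degree E v = card {e \<in> E. v \<in> e}"

text \<open>On \<open>nat\<close> the supremum of a finite nonempty set is its maximum, and \<open>Sup {} = 0\<close>.\<close>

definition max_degree :: "'a set \<Rightarrow> 'a set set \<Rightarrow> nat" where
  "max_degree V E = (SUP v\<in>V. degree E v)"

text \<open>The edges of \<open>K\<^bsub>a,n-a\<^esub>\<close>, on the vertex set \<open>{..<n}\<close> with parts \<open>{..<a}\<close> and \<open>{a..<n}\<close>.\<close>

definition complete_bipartite :: "nat \<Rightarrow> nat \<Rightarrow> nat set set" where
  "complete_bipartite n a = {{u, v} | u v. u \<in> {..<a} \<and> v \<in> {a..<n}}"

definition bipartite_complement :: "nat \<Rightarrow> nat \<Rightarrow> nat set set \<Rightarrow> nat set set" where
  "bipartite_complement n a E = complete_bipartite n a - E"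

text \<open>
  The minimum is over a finite set, which is nonempty for \<open>a = n div 2\<close> and \<open>2 * d \<le> n\<close>:
  the bipartite complement can be a star with \<open>d\<close> edges.
\<close>

definition min_max_different_perms :: "nat \<Rightarrow> nat \<Rightarrow> nat \<Rightarrow> nat" where
  "min_max_different_perms n a d =
     Min {max_different_perms {..<n} E | E.
            E \<subseteq> complete_bipartite n a \<and>
            max_degree {..<n} (bipartite_complement n a E) = d}"

end

theory Submission
  imports Defs "HOL-Real_Asymp.Real_Asymp"
begin

text \<open>
  If \<open>G\<close> lies in \<open>K\<^bsub>a,n-a\<^esub>\<close>, then \<open>G\<close>-different permutations differ in the set of positions that
  are filled from the first part, so \<open>F(G) \<le> 2\<^sup>n\<close>. For the lower bound fix \<open>m\<close>. Any \<open>m\<close> vertices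
  of the first part have at most \<open>m * \<Delta>\<close> non-neighbours in total, so copies of \<open>K\<^bsub>m,m\<^esub>\<close> can be
  split off \<open>G\<close> greedily until about \<open>m * \<Delta> = o(n)\<close> vertices are left on each side. Each copy
  contributes a factor \<open>(2 m choose m) \<ge> 4\<^sup>m / (2 m)\<close> by concatenation of permutations, which gives
  the rate \<open>1 - log\<^sub>2 (2 m) / (2 m)\<close>; finally let \<open>m\<close> grow.
\<close>

section \<open>Families of maximum size\<close>

text \<open>Makes \<open>Max\<close> in the definition meaningful. An infinite \<open>V\<close> is
  listed by no list, so finiteness holds for every \<open>V\<close>.\<close>

lemma finite_card_different_perms:
  "finite {card P | P. P \<subseteq> permutations_of_set V \<and> pairwise (graph_different E) P}"
proof -
  have "finite (permutations_of_set V)"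
    by simp
  then have "finite (card ` Pow (permutations_of_set V))"
    by blast
  then show ?thesis
    by (rule rev_finite_subset) auto
qed

lemma card_le_max_different_perms:
  assumes "P \<subseteq> permutations_of_set V" "pairwise (graph_different E) P"
  shows "card P \<le> max_different_perms V E"
  unfolding max_different_perms_def
  by (rule Max_ge[OF finite_card_different_perms]) (use assms in blast)

text \<open>The empty family always qualifies, so the maximum is over a nonempty finite set.\<close>

lemma max_different_perms_attained:
  obtains P where "P \<subseteq> permutations_of_set V" "pairwise (graph_different E) P"
    "card P = max_different_perms V E"
proof -
  have "{card P | P. P \<subseteq> permutations_of_set V \<and> pairwise (graph_different E) P} \<noteq> {}"
    by (auto intro!: exI[of _ "{}"])
  from Max_in[OF finite_card_different_perms this] show ?thesis
    using that unfolding max_different_perms_def by auto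
qed

text \<open>A one-element family is vacuously pairwise different. Positivity serves the base case of
  the greedy induction and the monotonicity of \<open>log\<close>.\<close>

lemma max_different_perms_pos:
  assumes "finite V"
  shows "1 \<le> max_different_perms V E"
proof -
  obtain p where "p \<in> permutations_of_set V"
    using assms permutations_of_set_empty_iff by blast
  then show ?thesis
    using card_le_max_different_perms[of "{p}" V E] by simp
qed

lemma length_permutation_of_set:
  "p \<in> permutations_of_set V \<Longrightarrow> length p = card V"
  by (auto simp: permutations_of_set_def distinct_card)

section \<open>Concatenation of permutations\<close>

text \<open>Prefixes of equal length keep the positions of both lists aligned, so a witnessing index
  survives; in the suffix it is shifted by that length.\<close>

lemma graph_different_appendI1:
  assumes "graph_different E p p'" "length p = length p'"
  shows "graph_different E (p @ q) (p' @ q')"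
proof -
  from assms(1) obtain i where "i < min (length p) (length p')" "{p ! i, p' ! i} \<in> E"
    unfolding graph_different_def by blast
  then show ?thesis
    unfolding graph_different_def using assms(2)
    by (intro exI[of _ i]) (auto simp: nth_append)
qed

lemma graph_different_appendI2:
  assumes "graph_different E q q'" "length p = length p'"
  shows "graph_different E (p @ q) (p' @ q')"
proof -
  from assms(1) obtain i where "i < min (length q) (length q')" "{q ! i, q' ! i} \<in> E"
    unfolding graph_different_def by blast
  then show ?thesis
    unfolding graph_different_def using assms(2)
    by (intro exI[of _ "length p + i"]) (auto simp: nth_append)
qed

text \<open>Append every member of an optimal family on \<open>W\<close> to every member of one on
  \<open>V\<close>. Two distinct concatenations differ in the first block, or agree there and differ
  in the second; either block supplies an edge.\<close>

lemma max_different_perms_union: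
  assumes "V \<inter> W = {}"
  shows "max_different_perms V E * max_different_perms W E \<le> max_different_perms (V \<union> W) E"
proof -
  obtain P where P: "P \<subseteq> permutations_of_set V" "pairwise (graph_different E) P"
    "card P = max_different_perms V E"
    by (rule max_different_perms_attained)
  obtain Q where Q: "Q \<subseteq> permutations_of_set W" "pairwise (graph_different E) Q"
    "card Q = max_different_perms W E"
    by (rule max_different_perms_attained)
  define R where "R = (\<lambda>(p, q). p @ q) ` (P \<times> Q)"
  have len: "length p = card V" if "p \<in> P" for p
    using that P(1) length_permutation_of_set by blast
  \<comment> \<open>All prefixes have length \<open>card V\<close>, so a concatenation determines
    its two blocks.\<close>
  have "inj_on (\<lambda>(p, q). p @ q) (P \<times> Q)"
    by (rule inj_onI) (auto simp: len)
  then have "card R = card P * card Q"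
    by (simp add: R_def card_image card_cartesian_product)
  moreover have "R \<subseteq> permutations_of_set (V \<union> W)"
    using P(1) Q(1) assms unfolding R_def permutations_of_set_def by fastforce
  moreover have "pairwise (graph_different E) R"
  proof (rule pairwiseI)
    fix r r' assume "r \<in> R" "r' \<in> R" "r \<noteq> r'"
    then obtain p q p' q' where
      r: "r = p @ q" "r' = p' @ q'" "p \<in> P" "q \<in> Q" "p' \<in> P" "q' \<in> Q"
      unfolding R_def by auto
    have l: "length p = length p'"
      using r len by simp
    show "graph_different E r r'"
    proof (cases "p = p'")
      case True
      then have "graph_different E q q'"
        using r \<open>r \<noteq> r'\<close> Q(2) by (auto simp: pairwise_def)
      then show ?thesis
        using r l graph_different_appendI2 by blast
    next
      case False
      then have "graph_different E p p'"
        using r P(2) by (auto simp: pairwise_def)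
      then show ?thesis
        using r l graph_different_appendI1 by blast
    qed
  qed
  ultimately show ?thesis
    using card_le_max_different_perms P(3) Q(3) by metis
qed

section \<open>Complete bipartite blocks\<close>

lemma permutation_with_pattern:
  assumes "finite A" "finite B" "A \<inter> B = {}" "S \<subseteq> {..<card A + card B}" "card S = card A"
  obtains p where "p \<in> permutations_of_set (A \<union> B)"
    "\<And>i. i < card A + card B \<Longrightarrow> (if i \<in> S then p ! i \<in> A else p ! i \<in> B)"
proof -
  define N where "N = {..<card A + card B}"
  have fS: "finite S" "S \<subseteq> N" "finite N"
    using assms finite_subset by (auto simp: N_def)
  then have "card (N - S) = card B"
    using assms by (simp add: card_Diff_subset N_def)
  then obtain g h where g: "bij_betw g S A" and h: "bij_betw h (N - S) B"
    using fS assms finite_same_card_bij[of S A] finite_same_card_bij[of "N - S" B] by auto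
  define f where "f i = (if i \<in> S then g i else h i)" for i
  have "bij_betw f S A" "bij_betw f (N - S) B"
    using g h bij_betw_cong[of S f g A] bij_betw_cong[of "N - S" f h B] by (auto simp: f_def)
  then have "bij_betw f (S \<union> (N - S)) (A \<union> B)"
    using assms(3) by (rule bij_betw_combine)
  then have f: "bij_betw f N (A \<union> B)"
    using fS(2) by (simp add: Un_absorb1)
  define p where "p = map f [0..<card A + card B]"
  have "distinct p" "set p = A \<union> B"
    using f by (auto simp: p_def distinct_map bij_betw_def N_def atLeast0LessThan)
  then have "p \<in> permutations_of_set (A \<union> B)"
    by (rule permutations_of_setI[rotated])
  moreover have "if i \<in> S then p ! i \<in> A else p ! i \<in> B" if "i < card A + card B" for i
    using that g h by (auto simp: p_def f_def N_def dest: bij_betwE)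
  ultimately show ?thesis
    by (rule that)
qed

text \<open>Choose one permutation for each set \<open>S\<close> of \<open>card A\<close> positions,
  filling exactly \<open>S\<close> from \<open>A\<close>. At a position in just one of two such
  sets, one permutation has a vertex of \<open>A\<close> and the other a vertex of \<open>B\<close>,
  which are adjacent.\<close>

lemma max_different_perms_complete_bipartite:
  assumes "finite A" "finite B" "A \<inter> B = {}"
    and edges: "\<And>a b. a \<in> A \<Longrightarrow> b \<in> B \<Longrightarrow> {a, b} \<in> E"
  shows "(card A + card B) choose card A \<le> max_different_perms (A \<union> B) E"
proof -
  define N where "N = card A + card B"
  define T where "T = {S. S \<subseteq> {..<N} \<and> card S = card A}"
  have "\<exists>p. p \<in> permutations_of_set (A \<union> B) \<and>
      (\<forall>i<N. if i \<in> S then p ! i \<in> A else p ! i \<in> B)" if "S \<in> T" for S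
  proof -
    have "S \<subseteq> {..<card A + card B}" "card S = card A"
      using that by (auto simp: T_def N_def)
    from permutation_with_pattern[OF assms(1-3) this] show ?thesis
      unfolding N_def by metis
  qed
  then obtain p where p: "\<And>S. S \<in> T \<Longrightarrow> p S \<in> permutations_of_set (A \<union> B)"
    "\<And>S i. S \<in> T \<Longrightarrow> i < N \<Longrightarrow> (if i \<in> S then p S ! i \<in> A else p S ! i \<in> B)"
    by metis
  have len: "length (p S) = N" if "S \<in> T" for S
    using length_permutation_of_set[OF p(1)[OF that]] assms
    by (simp add: card_Un_disjoint N_def)
  \<comment> \<open>The inequality is recorded separately because \<open>E\<close> is arbitrary here
    and might contain singletons; it yields injectivity of \<open>p\<close>.\<close>
  have different: "\<exists>i<N. {p S ! i, p S' ! i} \<in> E \<and> p S ! i \<noteq> p S' ! i"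
    if S: "S \<in> T" "S' \<in> T" "S \<noteq> S'" for S S'
  proof -
    obtain i where "i < N" "i \<in> S \<longleftrightarrow> i \<notin> S'"
      using S unfolding T_def by blast
    then show ?thesis
      using p(2)[OF S(1), of i] p(2)[OF S(2), of i] assms(3)
        edges[of "p S ! i" "p S' ! i"] edges[of "p S' ! i" "p S ! i"]
        insert_commute[of "p S ! i" "p S' ! i" "{}"]
      by (intro exI[of _ i]) (auto split: if_splits)
  qed
  have "inj_on p T"
    using different by (metis inj_onI)
  then have "card (p ` T) = card T"
    by (rule card_image)
  also have "\<dots> = N choose card A"
    unfolding T_def using n_subsets[of "{..<N}" "card A"] by simp
  finally have "card (p ` T) = N choose card A" .
  moreover have "pairwise (graph_different E) (p ` T)"
    unfolding pairwise_def graph_different_def using different len by fastforce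
  moreover have "p ` T \<subseteq> permutations_of_set (A \<union> B)"
    using p(1) by blast
  ultimately show ?thesis
    using card_le_max_different_perms unfolding N_def by metis
qed

section \<open>Greedy splitting\<close>

text \<open>Each round removes \<open>m\<close> vertices from each side. The slack
  \<open>m * d\<close> in \<open>B\<close> covers the non-neighbours of the chosen
  \<open>A1\<close>; these are only avoided, not deleted, so the same slack serves every round. The
  case \<open>k = 0\<close> carries no size condition, which suits a truncated subtraction
  later.\<close>

lemma max_different_perms_greedy:
  assumes "finite A" "finite B" "A \<inter> B = {}"
    and "\<And>a. a \<in> A \<Longrightarrow> card {b \<in> B. {a, b} \<notin> E} \<le> d"
    and "k = 0 \<or> k * m \<le> card A \<and> k * m + m * d \<le> card B"
  shows "((2 * m) choose m) ^ k \<le> max_different_perms (A \<union> B) E"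
  using assms
proof (induction k arbitrary: A B)
  case 0
  then show ?case
    using max_different_perms_pos[of "A \<union> B" E] by simp
next
  case (Suc k)
  note fin = Suc.prems(1,2)
  have sizes: "m + k * m \<le> card A" "m + k * m + m * d \<le> card B"
    using Suc.prems(5) by auto
  obtain A1 where A1: "A1 \<subseteq> A" "card A1 = m"
    using obtain_subset_with_card_n[of m A] sizes by auto
  define C where "C = (\<Union>a\<in>A1. {b \<in> B. {a, b} \<notin> E})"
  have fA1: "finite A1"
    using A1 fin finite_subset by blast
  have "card C \<le> (\<Sum>a\<in>A1. card {b \<in> B. {a, b} \<notin> E})"
    unfolding C_def by (rule card_UN_le[OF fA1])
  also have "\<dots> \<le> m * d"
    using sum_bounded_above[of A1 "\<lambda>a. card {b \<in> B. {a, b} \<notin> E}" d] Suc.prems(4) A1 by auto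
  finally have "card C \<le> m * d" .
  moreover have "card (B - C) = card B - card C"
    by (rule card_Diff_subset) (use fin in \<open>auto simp: C_def intro: finite_subset\<close>)
  ultimately have "m \<le> card (B - C)"
    using sizes by linarith
  then obtain B1 where B1: "B1 \<subseteq> B - C" "card B1 = m"
    using obtain_subset_with_card_n by metis
  have fB1: "finite B1"
    using B1 fin finite_subset by blast
  \<comment> \<open>Deleting vertices cannot create non-neighbours, so the induction continues with
    the same \<open>d\<close>.\<close>
  have "card {b \<in> B - B1. {a, b} \<notin> E} \<le> d" if "a \<in> A - A1" for a
    using Suc.prems(4)[of a] that card_mono[of "{b \<in> B. {a, b} \<notin> E}" "{b \<in> B - B1. {a, b} \<notin> E}"] fin
    by fastforce
  moreover have "card (A - A1) = card A - m"
    using A1 fA1 by (simp add: card_Diff_subset)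
  moreover have "card (B - B1) = card B - m"
    using B1 fB1 card_Diff_subset[of B1 B] by blast
  ultimately have IH: "((2 * m) choose m) ^ k \<le> max_different_perms ((A - A1) \<union> (B - B1)) E"
    using Suc.prems sizes by (intro Suc.IH) auto
  have "{a, b} \<in> E" if "a \<in> A1" "b \<in> B1" for a b
    using that B1 by (auto simp: C_def)
  moreover have "A1 \<inter> B1 = {}"
    using A1 B1 Suc.prems(3) by blast
  ultimately have "((2 * m) choose m) \<le> max_different_perms (A1 \<union> B1) E"
    using max_different_perms_complete_bipartite[of A1 B1 E] A1 B1 fA1 fB1
    by (simp add: mult_2)
  then have "((2 * m) choose m) ^ Suc k
      \<le> max_different_perms (A1 \<union> B1) E * max_different_perms ((A - A1) \<union> (B - B1)) E"
    using IH mult_le_mono by simp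
  also have "\<dots> \<le> max_different_perms ((A1 \<union> B1) \<union> ((A - A1) \<union> (B - B1))) E"
    by (rule max_different_perms_union) (use A1 B1 Suc.prems(3) in blast)
  also have "(A1 \<union> B1) \<union> ((A - A1) \<union> (B - B1)) = A \<union> B"
    using A1 B1 by blast
  finally show ?case .
qed

section \<open>Upper bound\<close>

text \<open>Every edge has exactly one end below \<open>a\<close>, so at an index witnessing the
  difference exactly one of the two permutations has an entry below \<open>a\<close>. Hence
  \<open>pattern\<close> is injective on the family.\<close>

lemma max_different_perms_le:
  assumes "E \<subseteq> complete_bipartite n a"
  shows "max_different_perms {..<n} E \<le> 2 ^ n"
proof -
  obtain P where P: "P \<subseteq> permutations_of_set {..<n}" "pairwise (graph_different E) P"
    "card P = max_different_perms {..<n} E"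
    by (rule max_different_perms_attained)
  define pattern where "pattern p = {i. i < n \<and> p ! i < a}" for p :: "nat list"
  have len: "length p = n" if "p \<in> P" for p
    using that P(1) length_permutation_of_set[of p "{..<n}"] by auto
  have "inj_on pattern P"
  proof (rule inj_onI, rule ccontr)
    fix p q assume pq: "p \<in> P" "q \<in> P" "pattern p = pattern q" "p \<noteq> q"
    then have "graph_different E p q"
      using P(2) by (auto simp: pairwise_def)
    then obtain i where i: "i < n" "{p ! i, q ! i} \<in> complete_bipartite n a"
      unfolding graph_different_def using pq len assms by auto
    then have "p ! i < a \<longleftrightarrow> \<not> q ! i < a"
      unfolding complete_bipartite_def by (auto simp: doubleton_eq_iff)
    then show False
      using pq(3) i(1) unfolding pattern_def by blast
  qed
  moreover have "pattern ` P \<subseteq> Pow {..<n}"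
    unfolding pattern_def by auto
  ultimately have "card P \<le> card (Pow {..<n})"
    by (rule card_inj_on_le) simp
  then show ?thesis
    using P(3) by (simp add: card_Pow)
qed

section \<open>Lower bound from the degree of the bipartite complement\<close>

lemma finite_complete_bipartite: "finite (complete_bipartite n a)"
  by (rule finite_subset[of _ "Pow {..<max n a}"]) (auto simp: complete_bipartite_def)

lemma degree_le_max_degree:
  assumes "finite V" "v \<in> V"
  shows "degree E v \<le> max_degree V E"
  unfolding max_degree_def using assms by (intro cSUP_upper) auto

lemma max_different_perms_ge:
  fixes m :: nat
  assumes "max_degree {..<n} (bipartite_complement n (n div 2) E) = d"
  shows "((2 * m) choose m) ^ (n div (2 * m) - d) \<le> max_different_perms {..<n} E"
proof -
  define a where "a = n div 2"
  define H where "H = bipartite_complement n a E"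
  have fH: "finite H"
    unfolding H_def bipartite_complement_def using finite_complete_bipartite by auto
  have "card {v \<in> {a..<n}. {u, v} \<notin> E} \<le> d" if u: "u \<in> {..<a}" for u
  proof -
    \<comment> \<open>Non-neighbours of \<open>u\<close> across the bipartition correspond to edges
      of the complement \<open>H\<close> at \<open>u\<close>.\<close>
    have "(\<lambda>v. {u, v}) ` {v \<in> {a..<n}. {u, v} \<notin> E} \<subseteq> {e \<in> H. u \<in> e}"
      using u unfolding H_def bipartite_complement_def complete_bipartite_def by auto
    moreover have "inj_on (\<lambda>v. {u, v}) {v \<in> {a..<n}. {u, v} \<notin> E}"
      by (rule inj_onI) (auto simp: doubleton_eq_iff)
    ultimately have "card {v \<in> {a..<n}. {u, v} \<notin> E} \<le> degree H u"
      unfolding degree_def using fH by (intro card_inj_on_le) auto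
    also have "\<dots> \<le> max_degree {..<n} H"
      using u by (intro degree_le_max_degree) (auto simp: a_def)
    finally show ?thesis
      using assms by (simp add: H_def a_def)
  qed
  moreover define k where "k = n div (2 * m) - d"
  have "k = 0 \<or> k * m \<le> card {..<a} \<and> k * m + m * d \<le> card {a..<n}"
  proof (cases "k = 0")
    case False
    \<comment> \<open>For \<open>k\<close> nonzero the subtraction is not truncated, so
      \<open>k * m + m * d\<close> is at most \<open>a\<close>, and both parts have at least
      \<open>a\<close> vertices.\<close>
    have "n div (2 * m) = a div m"
      by (simp add: a_def div_mult2_eq)
    then have "k + d = a div m"
      using False by (simp add: k_def)
    then have "k * m + m * d = (a div m) * m"
      by (metis distrib_right mult.commute)
    also have "\<dots> \<le> a"
      by (rule div_times_less_eq_dividend)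
    finally show ?thesis
      by (auto simp: a_def)
  qed auto
  ultimately have "((2 * m) choose m) ^ k \<le> max_different_perms ({..<a} \<union> {a..<n}) E"
    by (intro max_different_perms_greedy) auto
  also have "{..<a} \<union> {a..<n} = {..<n}"
    by (auto simp: a_def)
  finally show ?thesis
    by (simp add: k_def)
qed

section \<open>The minimum is attained\<close>

text \<open>For positive \<open>d\<close> the complement is a star centred at \<open>0\<close> with
  leaves \<open>{a..<a + d}\<close>, which fits since \<open>d\<close> is at most
  \<open>n div 2\<close>. For \<open>d = 0\<close> it is empty, and \<open>n = 0\<close> relies on
  \<open>Sup {} = 0\<close>.\<close>

lemma exists_bipartite_complement_max_degree:
  assumes "2 * d \<le> n"
  shows "\<exists>E. E \<subseteq> complete_bipartite n (n div 2) \<and>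
    max_degree {..<n} (bipartite_complement n (n div 2) E) = d"
proof (cases "d = 0")
  case True
  have "max_degree {..<n} {} = 0"
    unfolding max_degree_def degree_def by (cases "n = 0") (auto simp: Sup_nat_def)
  then show ?thesis
    using True
    by (intro exI[of _ "complete_bipartite n (n div 2)"]) (simp add: bipartite_complement_def)
next
  case False
  define a where "a = n div 2"
  define H where "H = (\<lambda>v. {0, v}) ` {a..<a + d}"
  have a: "0 < a" "d \<le> a" "a + d \<le> n"
    using False assms by (auto simp: a_def)
  have inj: "inj_on (\<lambda>v. {0, v}) {a..<a + d}"
    by (rule inj_onI) (auto simp: doubleton_eq_iff)
  have "{e \<in> H. 0 \<in> e} = H"
    by (auto simp: H_def)
  then have deg0: "degree H 0 = d"
    using card_image[OF inj] by (simp add: degree_def H_def)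
  have "card {e \<in> H. v \<in> e} \<le> card H" for v
    by (rule card_mono) (auto simp: H_def)
  then have deg: "degree H v \<le> d" for v
    using card_image[OF inj] by (simp add: degree_def H_def)
  have "max_degree {..<n} H = d"
  proof (rule antisym)
    show "max_degree {..<n} H \<le> d"
      unfolding max_degree_def
    proof (rule cSUP_least)
      show "{..<n} \<noteq> {}"
        using a by (auto simp: lessThan_empty_iff)
    qed (rule deg)
    show "d \<le> max_degree {..<n} H"
      using degree_le_max_degree[of "{..<n}" 0 H] deg0 a by auto
  qed
  moreover have "H \<subseteq> complete_bipartite n a"
    unfolding H_def complete_bipartite_def using a by fastforce
  then have "bipartite_complement n a (complete_bipartite n a - H) = H"
    unfolding bipartite_complement_def by blast
  ultimately show ?thesis
    unfolding a_def by (intro exI[of _ "complete_bipartite n a - H"]) (auto simp: a_def)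
qed

lemma min_max_different_perms_attained:
  assumes "2 * d \<le> n"
  obtains E where "E \<subseteq> complete_bipartite n (n div 2)"
    "max_degree {..<n} (bipartite_complement n (n div 2) E) = d"
    "min_max_different_perms n (n div 2) d = max_different_perms {..<n} E"
proof -
  let ?M = "{max_different_perms {..<n} E | E. E \<subseteq> complete_bipartite n (n div 2) \<and>
            max_degree {..<n} (bipartite_complement n (n div 2) E) = d}"
  have "finite (max_different_perms {..<n} ` Pow (complete_bipartite n (n div 2)))"
    using finite_complete_bipartite by simp
  then have "finite ?M"
    by (rule rev_finite_subset) auto
  moreover have "?M \<noteq> {}"
    using exists_bipartite_complement_max_degree[OF assms] by auto
  ultimately have "Min ?M \<in> ?M"
    by (rule Min_in)
  then show ?thesis
    using that unfolding min_max_different_perms_def by auto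
qed

section \<open>Logarithmic bounds and the limit\<close>

lemma log2_central_binomial_ge:
  assumes "0 < m"
  shows "2 * real m - log 2 (2 * real m) \<le> log 2 (real ((2 * m) choose m))"
proof -
  have "(4::real) ^ m = 2 ^ (2 * m)"
    by (simp add: power_mult)
  then have "2 * real m - log 2 (2 * real m) = log 2 (4 ^ m / (2 * real m))"
    using assms by (simp add: log_divide_pos)
  also have "\<dots> \<le> log 2 (real ((2 * m) choose m))"
    using assms central_binomial_lower_bound[OF assms] by (intro log_mono) auto
  finally show ?thesis .
qed

lemma log2_min_max_different_perms_ge:
  assumes "2 * d \<le> n" "0 < m"
  shows "(real n / (2 * real m) - 1 - real d) * (2 * real m - log 2 (2 * real m))
    \<le> log 2 (real (min_max_different_perms n (n div 2) d))"
proof -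
  let ?k = "n div (2 * m) - d" and ?c = "(2 * m) choose m"
  obtain E where E: "max_degree {..<n} (bipartite_complement n (n div 2) E) = d"
    "min_max_different_perms n (n div 2) d = max_different_perms {..<n} E"
    by (rule min_max_different_perms_attained[OF assms(1)])
  have "1 \<le> ?c"
    by (simp add: Suc_le_eq)
  \<comment> \<open>Gives a nonnegative second factor, so that the first factor may be enlarged to
    the integer \<open>?k\<close>.\<close>
  have "2 * real m \<le> 2 ^ (2 * m)"
    using of_nat_less_two_power[of "2 * m", where ?'a = real] by simp
  then have "log 2 (2 * real m) \<le> log 2 (2 ^ (2 * m))"
    using assms(2) by (intro log_mono) auto
  then have nonneg: "0 \<le> 2 * real m - log 2 (2 * real m)"
    by simp
  have "real n / real (2 * m) - 1 \<le> real (n div (2 * m))"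
    using real_of_int_floor_ge_diff_one[of "real n / real (2 * m)"]
    by (simp only: floor_divide_of_nat_eq of_int_of_nat_eq)
  \<comment> \<open>The \<open>1\<close> pays for rounding down; truncation at zero only increases
    \<open>?k\<close>.\<close>
  then have "real n / (2 * real m) - 1 - real d \<le> real ?k"
    by linarith
  then have "(real n / (2 * real m) - 1 - real d) * (2 * real m - log 2 (2 * real m))
      \<le> real ?k * (2 * real m - log 2 (2 * real m))"
    using nonneg by (rule mult_right_mono)
  also have "\<dots> \<le> real ?k * log 2 (real ?c)"
    by (intro mult_left_mono log2_central_binomial_ge assms) auto
  also have "\<dots> = log 2 (real (?c ^ ?k))"
    using \<open>1 \<le> ?c\<close> by (simp add: log_nat_power)
  also have "\<dots> \<le> log 2 (real (max_different_perms {..<n} E))"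
    using max_different_perms_ge[OF E(1), of m] \<open>1 \<le> ?c\<close> max_different_perms_pos[of "{..<n}" E]
    by (intro log_mono) (auto simp del: of_nat_power)
  finally show ?thesis
    using E(2) by simp
qed

lemma log2_min_max_different_perms_le:
  assumes "2 * d \<le> n"
  shows "log 2 (real (min_max_different_perms n (n div 2) d)) \<le> real n"
proof -
  obtain E where E: "E \<subseteq> complete_bipartite n (n div 2)"
    "min_max_different_perms n (n div 2) d = max_different_perms {..<n} E"
    by (rule min_max_different_perms_attained[OF assms])
  have "real (max_different_perms {..<n} E) \<le> 2 ^ n"
    using max_different_perms_le[OF E(1)] by (metis of_nat_le_iff of_nat_numeral of_nat_power)
  then have "log 2 (real (max_different_perms {..<n} E)) \<le> log 2 (2 ^ n)"
    using max_different_perms_pos[of "{..<n}" E] by (intro log_mono) auto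
  then show ?thesis
    using E(2) by simp
qed

theorem theorem3:
  fixes \<Delta> :: "nat \<Rightarrow> nat"
  assumes "\<And>n. 2 * \<Delta> n \<le> n"
    and "(\<lambda>n. real (\<Delta> n)) \<in> o(\<lambda>n. real n)"
  shows "(\<lambda>n. 1 / real n * log 2 (real (min_max_different_perms n (n div 2) (\<Delta> n))))
           \<longlonglongrightarrow> 1"
proof (rule order_tendstoI)
  let ?f = "\<lambda>n. 1 / real n * log 2 (real (min_max_different_perms n (n div 2) (\<Delta> n)))"
  have "(\<lambda>n. real (\<Delta> n) / real n) \<longlonglongrightarrow> 0"
    by (rule smalloD_tendsto[OF assms(2)])
  \<comment> \<open>With \<open>m\<close> fixed, both the rounding loss and
    \<open>\<Delta> n\<close> vanish after division by \<open>n\<close>.\<close>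
  then have lower_limit: "(\<lambda>n. (1 / (2 * real m) - 1 / real n - real (\<Delta> n) / real n) * c)
      \<longlonglongrightarrow> (1 / (2 * real m) - 0 - 0) * c" for m c
    by (intro tendsto_intros lim_1_over_n)
  fix y :: real
  {
    assume "y < 1"
    \<comment> \<open>The block size \<open>m\<close> is fixed first, with rate above
      \<open>y\<close>; only then does \<open>n\<close> grow.\<close>
    have "(\<lambda>m. 1 - log 2 (2 * real m) / (2 * real m)) \<longlonglongrightarrow> 1"
      by real_asymp
    then have "\<forall>\<^sub>F m in sequentially. y < 1 - log 2 (2 * real m) / (2 * real m)"
      using \<open>y < 1\<close> by (rule order_tendstoD)
    then have "\<forall>\<^sub>F m in sequentially. 0 < m \<and> y < 1 - log 2 (2 * real m) / (2 * real m)"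
      using eventually_gt_at_top eventually_conj by blast
    then obtain m :: nat where m: "0 < m" "y < 1 - log 2 (2 * real m) / (2 * real m)"
      by (metis (no_types, lifting) eventually_happens' sequentially_bot)
    define c where "c = 2 * real m - log 2 (2 * real m)"
    have "y < (1 / (2 * real m) - 0 - 0) * c"
      using m by (simp add: c_def field_simps)
    with lower_limit have
      "\<forall>\<^sub>F n in sequentially. y < (1 / (2 * real m) - 1 / real n - real (\<Delta> n) / real n) * c"
      by (rule order_tendstoD)
    then show "\<forall>\<^sub>F n in sequentially. y < ?f n"
      using eventually_gt_at_top[of 0]
    proof eventually_elim
      case (elim n)
      have "(1 / (2 * real m) - 1 / real n - real (\<Delta> n) / real n) * c
          = 1 / real n * ((real n / (2 * real m) - 1 - real (\<Delta> n)) * c)"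
        using elim(2) by (simp add: field_simps)
      also have "\<dots> \<le> ?f n"
        unfolding c_def
        by (intro mult_left_mono log2_min_max_different_perms_ge assms(1) m(1)) auto
      finally show ?case
        using elim(1) by linarith
    qed
  }
  {
    assume "1 < y"
    show "\<forall>\<^sub>F n in sequentially. ?f n < y"
      using eventually_gt_at_top[of 0]
    proof eventually_elim
      case (elim n)
      have "?f n \<le> 1 / real n * real n"
        by (intro mult_left_mono log2_min_max_different_perms_le assms(1)) auto
      also have "\<dots> < y"
        using \<open>1 < y\<close> elim by simp
      finally show ?case .
    qed
  }
qed

end
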